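(* Let $\Gamma = x_1:A_1,\dots,x_n:A_n$ be a context, $t$ a proof-term and $A$ a proposition with $\Gamma\vdash t:A$, and let $\sigma$ be a substitution mapping each variable $x_i$ to an element of $[\![A_i]\!]$. Then $\sigma t\in[\![A]\!]$.
   Context: The $\odot$-calculus. Propositions: $A ::= \top \mid \bot \mid A \Rightarrow A \mid A \wedge A \mid A \vee A \mid A \odot A$. Proof-terms: $t ::= x \mid t \parallel u \mid * \mid \delta_\bot(t) \mid \lambda x\, t \mid t\,u \mid \langle t,u\rangle \mid \delta_\wedge(t,[x,y]u) \mid \mathrm{inl}(t) \mid \mathrm{inr}(t) \mid \delta_\vee(t,[x]u,[y]v) \mid t+u \mid \delta_\odot(t,[x]u,[y]v) \mid \delta_\odot^\parallel(t,[x]u,[y]v)$, where $\lambda x$ binds $x$, $[x,y]$ binds $x,y$, and $[x]$, $[y]$ bind $x$, $y$; $(u/x)t$ is capture-avoiding substitution. Typing rules: $\Gamma\vdash x:A$ if $x:A\in\Gamma$; from $\Gamma\vdash t:A$ and $\Gamma\vdash u:A$ infer $\Gamma\vdash t\parallel u:A$; $\Gamma\vdash *:\top$; from $\Gamma\vdash t:\bot$ infer $\Gamma\vdash\delta_\bot(t):C$; from $\Gamma,x:A\vdash t:B$ infer $\Gamma\vdash\lambda x\,t:A\Rightarrow B$; from $\Gamma\vdash t:A\Rightarrow B$ and $\Gamma\vdash u:A$ infer $\Gamma\vdash t\,u:B$; from $\Gamma\vdash t:A$, $\Gamma\vdash u:B$ infer $\Gamma\vdash\langle t,u\rangle:A\wedge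 B$; from $\Gamma\vdash t:A\wedge B$ and $\Gamma,x:A,y:B\vdash u:C$ infer $\Gamma\vdash\delta_\wedge(t,[x,y]u):C$; from $\Gamma\vdash t:A$ infer $\Gamma\vdash\mathrm{inl}(t):A\vee B$; from $\Gamma\vdash t:B$ infer $\Gamma\vdash\mathrm{inr}(t):A\vee B$; from $\Gamma\vdash t:A\vee B$, $\Gamma,x:A\vdash u:C$, $\Gamma,y:B\vdash v:C$ infer $\Gamma\vdash\delta_\vee(t,[x]u,[y]v):C$; from $\Gamma\vdash t:A$, $\Gamma\vdash u:B$ infer $\Gamma\vdash t+u:A\odot B$; from $\Gamma\vdash t:A\odot B$, $\Gamma,x:A\vdash u:C$, $\Gamma,y:B\vdash v:C$ infer both $\Gamma\vdash\delta_\odot(t,[x]u,[y]v):C$ and $\Gamma\vdash\delta_\odot^\parallel(t,[x]u,[y]v):C$. Ultra-reduction $\longrightarrow$ is the smallest contextual relation (closed under all term constructors) containing $\sigma l\to\sigma r$ for every substitution $\sigma$ and every rule $l\to r$ among: $(\lambda x\,t)\,u\to(u/x)t$; $\delta_\wedge(\langle t,u\rangle,[x,y]v)\to(t/x,u/y)v$; $\delta_\vee(\mathrm{inl}(t),[x]v,[y]w)\to(t/x)v$; $\delta_\vee(\mathrm{inr}(u),[x]v,[y]w)\to(u/y)w$; $\delta_\odot(t+u,[x]v,[y]w)\to(t/x)v$; $\delta_\odot(t+u,[x]v,[y]w)\to(u/y)w$; $\delta_\odot^\parallel(t+u,[x]v,[y]w)\to(t/x)v\parallel(u/y)w$; $(\lambda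 x\,t)\parallel(\lambda x\,u)\to\lambda x\,(t\parallel u)$; $\langle t,u\rangle\parallel\langle v,w\rangle\to\langle t\parallel v,u\parallel w\rangle$; $\delta_\vee(t\parallel u,[x]v,[y]w)\to\delta_\vee(t,[x]v,[y]w)\parallel\delta_\vee(u,[x]v,[y]w)$; $(t+u)\parallel(v+w)\to(t\parallel v)+(u\parallel w)$; $t\parallel t\to t$; $t\parallel u\to t$; $t\parallel u\to u$. $\longrightarrow^*$ is its reflexive-transitive closure; $t$ strongly terminates if there is no infinite ultra-reduction sequence from $t$. Sets $[\![A]\!]$ are defined by induction on $A$: $t\in[\![\top]\!]$ and $t\in[\![\bot]\!]$ iff $t$ strongly terminates; $t\in[\![A\Rightarrow B]\!]$ iff $t$ strongly terminates and whenever $t\longrightarrow^*\lambda x\,u$, then $(v/x)u\in[\![B]\!]$ for every $v\in[\![A]\!]$; $t\in[\![A\wedge B]\!]$ iff $t$ strongly terminates and whenever $t\longrightarrow^*\langle u,v\rangle$, then $u\in[\![A]\!]$ and $v\in[\![B]\!]$; $t\in[\![A\vee B]\!]$ iff $t$ strongly terminates, whenever $t\longrightarrow^*\mathrm{inl}(u)$ then $u\in[\![A]\!]$, and whenever $t\longrightarrow^*\mathrm{inr}(v)$ then $v\in[\![B]\!]$; $t\in[\![A\odot B]\!]$ iff $t$ strongly terminates and whenever $t\longrightarrow^* u+v$, then $u\in[\![A]\!]$ and $v\in[\![B]\!]$. *)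

theory Defs
  imports Main
begin

text \<open>
  Proof-terms are taken modulo alpha-equivalence by means of de Bruijn indices. A context
  \<open>x\<^sub>1 : A\<^sub>1, \<dots>, x\<^sub>n : A\<^sub>n\<close> is a list of propositions whose entry at position \<open>i\<close> is the type of
  the variable with index \<open>i\<close>; the most recently declared variable comes first, so that
  \<open>\<Gamma>, x : A\<close> is \<open>A # \<Gamma>\<close>.
\<close>

datatype fm =
    Top
  | Bot
  | Imp fm fm
  | Conj fm fm
  | Disj fm fm
  | Odot fm fm

text \<open>
  \<open>DeltaOdot\<close> is the non-deterministic elimination and \<open>DeltaOdotPar\<close> the parallel one.
  \<open>Lam\<close> and the branches of \<open>DeltaDisj\<close>, \<open>DeltaOdot\<close>, \<open>DeltaOdotPar\<close> bind index 0. The body of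
  \<open>DeltaConj t u\<close>, written \<open>[x,y]u\<close> with names, binds two variables: \<open>y\<close> is index 0 and
  \<open>x\<close> is index 1.
\<close>

datatype trm =
    Var nat
  | Par trm trm
  | Star
  | DeltaBot trm
  | Lam trm
  | App trm trm
  | Pair trm trm
  | DeltaConj trm trm
  | InL trm
  | InR trm
  | DeltaDisj trm trm trm
  | Plus trm trm
  | DeltaOdot trm trm trm
  | DeltaOdotPar trm trm trm

definition lift_ren :: "(nat \<Rightarrow> nat) \<Rightarrow> nat \<Rightarrow> nat" where
  "lift_ren \<rho> = case_nat 0 (\<lambda>n. Suc (\<rho> n))"

primrec rename :: "(nat \<Rightarrow> nat) \<Rightarrow> trm \<Rightarrow> trm" where
  "rename \<rho> (Var n) = Var (\<rho> n)"
| "rename \<rho> (Par t u) = Par (rename \<rho> t) (rename \<rho> u)"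
| "rename \<rho> Star = Star"
| "rename \<rho> (DeltaBot t) = DeltaBot (rename \<rho> t)"
| "rename \<rho> (Lam t) = Lam (rename (lift_ren \<rho>) t)"
| "rename \<rho> (App t u) = App (rename \<rho> t) (rename \<rho> u)"
| "rename \<rho> (Pair t u) = Pair (rename \<rho> t) (rename \<rho> u)"
| "rename \<rho> (DeltaConj t u) = DeltaConj (rename \<rho> t) (rename (lift_ren (lift_ren \<rho>)) u)"
| "rename \<rho> (InL t) = InL (rename \<rho> t)"
| "rename \<rho> (InR t) = InR (rename \<rho> t)"
| "rename \<rho> (DeltaDisj t u v) =
     DeltaDisj (rename \<rho> t) (rename (lift_ren \<rho>) u) (rename (lift_ren \<rho>) v)"
| "rename \<rho> (Plus t u) = Plus (rename \<rho> t) (rename \<rho> u)"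
| "rename \<rho> (DeltaOdot t u v) =
     DeltaOdot (rename \<rho> t) (rename (lift_ren \<rho>) u) (rename (lift_ren \<rho>) v)"
| "rename \<rho> (DeltaOdotPar t u v) =
     DeltaOdotPar (rename \<rho> t) (rename (lift_ren \<rho>) u) (rename (lift_ren \<rho>) v)"

definition lift_sub :: "(nat \<Rightarrow> trm) \<Rightarrow> nat \<Rightarrow> trm" where
  "lift_sub \<sigma> = case_nat (Var 0) (\<lambda>n. rename Suc (\<sigma> n))"

primrec subst :: "(nat \<Rightarrow> trm) \<Rightarrow> trm \<Rightarrow> trm" where
  "subst \<sigma> (Var n) = \<sigma> n"
| "subst \<sigma> (Par t u) = Par (subst \<sigma> t) (subst \<sigma> u)"
| "subst \<sigma> Star = Star"
| "subst \<sigma> (DeltaBot t) = DeltaBot (subst \<sigma> t)"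
| "subst \<sigma> (Lam t) = Lam (subst (lift_sub \<sigma>) t)"
| "subst \<sigma> (App t u) = App (subst \<sigma> t) (subst \<sigma> u)"
| "subst \<sigma> (Pair t u) = Pair (subst \<sigma> t) (subst \<sigma> u)"
| "subst \<sigma> (DeltaConj t u) = DeltaConj (subst \<sigma> t) (subst (lift_sub (lift_sub \<sigma>)) u)"
| "subst \<sigma> (InL t) = InL (subst \<sigma> t)"
| "subst \<sigma> (InR t) = InR (subst \<sigma> t)"
| "subst \<sigma> (DeltaDisj t u v) =
     DeltaDisj (subst \<sigma> t) (subst (lift_sub \<sigma>) u) (subst (lift_sub \<sigma>) v)"
| "subst \<sigma> (Plus t u) = Plus (subst \<sigma> t) (subst \<sigma> u)"
| "subst \<sigma> (DeltaOdot t u v) =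
     DeltaOdot (subst \<sigma> t) (subst (lift_sub \<sigma>) u) (subst (lift_sub \<sigma>) v)"
| "subst \<sigma> (DeltaOdotPar t u v) =
     DeltaOdotPar (subst \<sigma> t) (subst (lift_sub \<sigma>) u) (subst (lift_sub \<sigma>) v)"

text \<open>
  \<open>subst1 u t\<close> is \<open>(u/x)t\<close> for \<open>x\<close> the variable of index 0, and \<open>subst2 t u v\<close> is
  \<open>(t/x, u/y)v\<close> for \<open>x\<close> of index 1 and \<open>y\<close> of index 0. Both remove the substituted
  variables from the index count.
\<close>

definition subst1 :: "trm \<Rightarrow> trm \<Rightarrow> trm" where
  "subst1 u t = subst (case_nat u Var) t"

definition subst2 :: "trm \<Rightarrow> trm \<Rightarrow> trm \<Rightarrow> trm" where
  "subst2 t u v = subst (case_nat u (case_nat t Var)) v"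

inductive typing :: "fm list \<Rightarrow> trm \<Rightarrow> fm \<Rightarrow> bool" ("_ \<turnstile> _ : _" [50, 50, 50] 50) where
  ty_Var: "i < length \<Gamma> \<Longrightarrow> \<Gamma> ! i = A \<Longrightarrow> \<Gamma> \<turnstile> Var i : A"
| ty_Par: "\<Gamma> \<turnstile> t : A \<Longrightarrow> \<Gamma> \<turnstile> u : A \<Longrightarrow> \<Gamma> \<turnstile> Par t u : A"
| ty_Star: "\<Gamma> \<turnstile> Star : Top"
| ty_DeltaBot: "\<Gamma> \<turnstile> t : Bot \<Longrightarrow> \<Gamma> \<turnstile> DeltaBot t : C"
| ty_Lam: "A # \<Gamma> \<turnstile> t : B \<Longrightarrow> \<Gamma> \<turnstile> Lam t : Imp A B"
| ty_App: "\<Gamma> \<turnstile> t : Imp A B \<Longrightarrow> \<Gamma> \<turnstile> u : A \<Longrightarrow> \<Gamma> \<turnstile> App t u : B"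
| ty_Pair: "\<Gamma> \<turnstile> t : A \<Longrightarrow> \<Gamma> \<turnstile> u : B \<Longrightarrow> \<Gamma> \<turnstile> Pair t u : Conj A B"
| ty_DeltaConj: "\<Gamma> \<turnstile> t : Conj A B \<Longrightarrow> B # A # \<Gamma> \<turnstile> u : C \<Longrightarrow> \<Gamma> \<turnstile> DeltaConj t u : C"
| ty_InL: "\<Gamma> \<turnstile> t : A \<Longrightarrow> \<Gamma> \<turnstile> InL t : Disj A B"
| ty_InR: "\<Gamma> \<turnstile> t : B \<Longrightarrow> \<Gamma> \<turnstile> InR t : Disj A B"
| ty_DeltaDisj: "\<Gamma> \<turnstile> t : Disj A B \<Longrightarrow> A # \<Gamma> \<turnstile> u : C \<Longrightarrow> B # \<Gamma> \<turnstile> v : C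
    \<Longrightarrow> \<Gamma> \<turnstile> DeltaDisj t u v : C"
| ty_Plus: "\<Gamma> \<turnstile> t : A \<Longrightarrow> \<Gamma> \<turnstile> u : B \<Longrightarrow> \<Gamma> \<turnstile> Plus t u : Odot A B"
| ty_DeltaOdot: "\<Gamma> \<turnstile> t : Odot A B \<Longrightarrow> A # \<Gamma> \<turnstile> u : C \<Longrightarrow> B # \<Gamma> \<turnstile> v : C
    \<Longrightarrow> \<Gamma> \<turnstile> DeltaOdot t u v : C"
| ty_DeltaOdotPar: "\<Gamma> \<turnstile> t : Odot A B \<Longrightarrow> A # \<Gamma> \<turnstile> u : C \<Longrightarrow> B # \<Gamma> \<turnstile> v : C
    \<Longrightarrow> \<Gamma> \<turnstile> DeltaOdotPar t u v : C"

inductive red_rule :: "trm \<Rightarrow> trm \<Rightarrow> bool" where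
  rule_beta: "red_rule (App (Lam t) u) (subst1 u t)"
| rule_conj: "red_rule (DeltaConj (Pair t u) v) (subst2 t u v)"
| rule_disjL: "red_rule (DeltaDisj (InL t) v w) (subst1 t v)"
| rule_disjR: "red_rule (DeltaDisj (InR u) v w) (subst1 u w)"
| rule_odotL: "red_rule (DeltaOdot (Plus t u) v w) (subst1 t v)"
| rule_odotR: "red_rule (DeltaOdot (Plus t u) v w) (subst1 u w)"
| rule_odotPar: "red_rule (DeltaOdotPar (Plus t u) v w) (Par (subst1 t v) (subst1 u w))"
| rule_parLam: "red_rule (Par (Lam t) (Lam u)) (Lam (Par t u))"
| rule_parPair: "red_rule (Par (Pair t u) (Pair v w)) (Pair (Par t v) (Par u w))"
| rule_parDisj: "red_rule (DeltaDisj (Par t u) v w) (Par (DeltaDisj t v w) (DeltaDisj u v w))"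
| rule_parPlus: "red_rule (Par (Plus t u) (Plus v w)) (Plus (Par t v) (Par u w))"
| rule_parIdem: "red_rule (Par t t) t"
| rule_parL: "red_rule (Par t u) t"
| rule_parR: "red_rule (Par t u) u"

text \<open>
  Ultra-reduction: the contextual closure of all instances \<open>\<sigma>l \<leadsto> \<sigma>r\<close> of rules. As the rules
  above are schematic in the proof-terms \<open>t, u, v, w\<close>, taking \<open>\<sigma> = Var\<close> would give the same
  relation.
\<close>

inductive ured :: "trm \<Rightarrow> trm \<Rightarrow> bool" (infix "\<leadsto>" 50) where
  ured_rule: "red_rule l r \<Longrightarrow> subst \<sigma> l \<leadsto> subst \<sigma> r"
| ured_Par1: "t \<leadsto> t' \<Longrightarrow> Par t u \<leadsto> Par t' u"
| ured_Par2: "u \<leadsto> u' \<Longrightarrow> Par t u \<leadsto> Par t u'"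
| ured_DeltaBot: "t \<leadsto> t' \<Longrightarrow> DeltaBot t \<leadsto> DeltaBot t'"
| ured_Lam: "t \<leadsto> t' \<Longrightarrow> Lam t \<leadsto> Lam t'"
| ured_App1: "t \<leadsto> t' \<Longrightarrow> App t u \<leadsto> App t' u"
| ured_App2: "u \<leadsto> u' \<Longrightarrow> App t u \<leadsto> App t u'"
| ured_Pair1: "t \<leadsto> t' \<Longrightarrow> Pair t u \<leadsto> Pair t' u"
| ured_Pair2: "u \<leadsto> u' \<Longrightarrow> Pair t u \<leadsto> Pair t u'"
| ured_DeltaConj1: "t \<leadsto> t' \<Longrightarrow> DeltaConj t u \<leadsto> DeltaConj t' u"
| ured_DeltaConj2: "u \<leadsto> u' \<Longrightarrow> DeltaConj t u \<leadsto> DeltaConj t u'"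
| ured_InL: "t \<leadsto> t' \<Longrightarrow> InL t \<leadsto> InL t'"
| ured_InR: "t \<leadsto> t' \<Longrightarrow> InR t \<leadsto> InR t'"
| ured_DeltaDisj1: "t \<leadsto> t' \<Longrightarrow> DeltaDisj t u v \<leadsto> DeltaDisj t' u v"
| ured_DeltaDisj2: "u \<leadsto> u' \<Longrightarrow> DeltaDisj t u v \<leadsto> DeltaDisj t u' v"
| ured_DeltaDisj3: "v \<leadsto> v' \<Longrightarrow> DeltaDisj t u v \<leadsto> DeltaDisj t u v'"
| ured_Plus1: "t \<leadsto> t' \<Longrightarrow> Plus t u \<leadsto> Plus t' u"
| ured_Plus2: "u \<leadsto> u' \<Longrightarrow> Plus t u \<leadsto> Plus t u'"
| ured_DeltaOdot1: "t \<leadsto> t' \<Longrightarrow> DeltaOdot t u v \<leadsto> DeltaOdot t' u v"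
| ured_DeltaOdot2: "u \<leadsto> u' \<Longrightarrow> DeltaOdot t u v \<leadsto> DeltaOdot t u' v"
| ured_DeltaOdot3: "v \<leadsto> v' \<Longrightarrow> DeltaOdot t u v \<leadsto> DeltaOdot t u v'"
| ured_DeltaOdotPar1: "t \<leadsto> t' \<Longrightarrow> DeltaOdotPar t u v \<leadsto> DeltaOdotPar t' u v"
| ured_DeltaOdotPar2: "u \<leadsto> u' \<Longrightarrow> DeltaOdotPar t u v \<leadsto> DeltaOdotPar t u' v"
| ured_DeltaOdotPar3: "v \<leadsto> v' \<Longrightarrow> DeltaOdotPar t u v \<leadsto> DeltaOdotPar t u v'"

abbreviation ureds :: "trm \<Rightarrow> trm \<Rightarrow> bool" (infix "\<leadsto>*" 50) where
  "t \<leadsto>* u \<equiv> ured\<^sup>*\<^sup>* t u"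

definition strongly_terminates :: "trm \<Rightarrow> bool" where
  "strongly_terminates t \<longleftrightarrow> \<not> (\<exists>f :: nat \<Rightarrow> trm. f 0 = t \<and> (\<forall>i. f i \<leadsto> f (Suc i)))"

primrec interp :: "fm \<Rightarrow> trm set" ("\<lbrakk>_\<rbrakk>") where
  "\<lbrakk>Top\<rbrakk> = {t. strongly_terminates t}"
| "\<lbrakk>Bot\<rbrakk> = {t. strongly_terminates t}"
| "\<lbrakk>Imp A B\<rbrakk> = {t. strongly_terminates t \<and>
     (\<forall>u. t \<leadsto>* Lam u \<longrightarrow> (\<forall>v\<in>\<lbrakk>A\<rbrakk>. subst1 v u \<in> \<lbrakk>B\<rbrakk>))}"
| "\<lbrakk>Conj A B\<rbrakk> = {t. strongly_terminates t \<and>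
     (\<forall>u v. t \<leadsto>* Pair u v \<longrightarrow> u \<in> \<lbrakk>A\<rbrakk> \<and> v \<in> \<lbrakk>B\<rbrakk>)}"
| "\<lbrakk>Disj A B\<rbrakk> = {t. strongly_terminates t \<and>
     (\<forall>u. t \<leadsto>* InL u \<longrightarrow> u \<in> \<lbrakk>A\<rbrakk>) \<and> (\<forall>v. t \<leadsto>* InR v \<longrightarrow> v \<in> \<lbrakk>B\<rbrakk>)}"
| "\<lbrakk>Odot A B\<rbrakk> = {t. strongly_terminates t \<and>
     (\<forall>u v. t \<leadsto>* Plus u v \<longrightarrow> u \<in> \<lbrakk>A\<rbrakk> \<and> v \<in> \<lbrakk>B\<rbrakk>)}"

end

theory Submission
  imports Defs
begin

text \<open>
  Reducibility in the style of Girard. The sets \<open>\<lbrakk>A\<rbrakk>\<close> are closed under ultra-reduction, and they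
  contain every term that is not an introduction and all of whose one-step reducts they contain.
  Together with the adequacy of each constructor this gives the theorem by induction on typing.
  The delicate constructor is \<open>Par\<close>: since it commutes with introductions, the termination of
  \<open>Par t u\<close> is proved by induction on reduction combined with the subterm order, which is still
  well-founded below a strongly terminating term.
\<close>

section \<open>Substitution\<close>

lemma lift_ren_simps [simp]:
  "lift_ren \<rho> 0 = 0" "lift_ren \<rho> (Suc n) = Suc (\<rho> n)"
  by (simp_all add: lift_ren_def)

lemma lift_sub_simps [simp]:
  "lift_sub \<sigma> 0 = Var 0" "lift_sub \<sigma> (Suc n) = rename Suc (\<sigma> n)"
  by (simp_all add: lift_sub_def)

text \<open>Renamings come before substitutions because \<open>lift_sub\<close> is built from
  \<open>rename\<close>: the lifting law for two substitutions rests on \<open>subst_rename\<close>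
  and \<open>rename_subst\<close>.\<close>

lemma lift_ren_comp: "lift_ren \<rho> \<circ> lift_ren \<rho>' = lift_ren (\<rho> \<circ> \<rho>')"
  by (rule ext, rename_tac n, case_tac n) simp_all

lemma rename_rename: "rename \<rho> (rename \<rho>' t) = rename (\<rho> \<circ> \<rho>') t"
  by (induction t arbitrary: \<rho> \<rho>') (simp_all add: lift_ren_comp)

lemma lift_sub_lift_ren: "lift_sub \<sigma> \<circ> lift_ren \<rho> = lift_sub (\<sigma> \<circ> \<rho>)"
  by (rule ext, rename_tac n, case_tac n) simp_all

lemma subst_rename: "subst \<sigma> (rename \<rho> t) = subst (\<sigma> \<circ> \<rho>) t"
  by (induction t arbitrary: \<sigma> \<rho>) (simp_all add: lift_sub_lift_ren)

lemma rename_lift_sub: "rename (lift_ren \<rho>) \<circ> lift_sub \<sigma> = lift_sub (rename \<rho> \<circ> \<sigma>)"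
  by (rule ext, rename_tac n, case_tac n) (simp_all add: rename_rename comp_def)

lemma rename_subst: "rename \<rho> (subst \<sigma> t) = subst (rename \<rho> \<circ> \<sigma>) t"
  by (induction t arbitrary: \<sigma> \<rho>) (simp_all add: rename_lift_sub)

lemma subst_lift_sub: "subst (lift_sub \<tau>) \<circ> lift_sub \<sigma> = lift_sub (subst \<tau> \<circ> \<sigma>)"
  by (rule ext, rename_tac n, case_tac n) (simp_all add: subst_rename rename_subst comp_def)

lemma subst_subst: "subst \<tau> (subst \<sigma> t) = subst (subst \<tau> \<circ> \<sigma>) t"
  by (induction t arbitrary: \<sigma> \<tau>) (simp_all add: subst_lift_sub)

lemma lift_sub_Var: "lift_sub Var = Var"
  by (rule ext, rename_tac n, case_tac n) simp_all

lemma subst_Var: "subst Var t = t"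
  by (induction t) (simp_all add: lift_sub_Var)

lemma case_nat_lift_sub: "subst (case_nat a \<tau>) \<circ> lift_sub \<sigma> = case_nat a (subst \<tau> \<circ> \<sigma>)"
  by (rule ext, rename_tac n, case_tac n) (simp_all add: subst_rename comp_def)

lemma subst_comp_Var: "subst Var \<circ> \<sigma> = \<sigma>" "subst \<sigma> \<circ> Var = \<sigma>"
  by (auto simp: subst_Var)

lemma subst_comp_case_nat: "subst \<sigma> \<circ> case_nat a \<tau> = case_nat (subst \<sigma> a) (subst \<sigma> \<circ> \<tau>)"
  by (rule ext, rename_tac n, case_tac n) simp_all

text \<open>Contracting a redex after \<open>\<sigma>\<close> has passed under its binder is one
  simultaneous substitution. In this form the induction hypotheses of the binding rules
  apply.\<close>

lemma subst1_subst: "subst1 a (subst (lift_sub \<sigma>) t) = subst (case_nat a \<sigma>) t"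
  by (simp add: subst1_def subst_subst case_nat_lift_sub subst_comp_Var)

lemma subst2_subst:
  "subst2 a b (subst (lift_sub (lift_sub \<sigma>)) t) = subst (case_nat b (case_nat a \<sigma>)) t"
  by (simp add: subst2_def subst_subst case_nat_lift_sub subst_comp_Var)

text \<open>Both sides collapse to the simultaneous substitution
  \<open>case_nat (subst \<sigma> u) \<sigma>\<close>.\<close>

lemma subst_subst1: "subst \<sigma> (subst1 u t) = subst1 (subst \<sigma> u) (subst (lift_sub \<sigma>) t)"
  unfolding subst1_subst by (simp add: subst1_def subst_subst subst_comp_case_nat subst_comp_Var)

lemma subst_subst2:
  "subst \<sigma> (subst2 t u v) = subst2 (subst \<sigma> t) (subst \<sigma> u) (subst (lift_sub (lift_sub \<sigma>)) v)"
  unfolding subst2_subst by (simp add: subst2_def subst_subst subst_comp_case_nat subst_comp_Var)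

section \<open>Inversion of ultra-reduction\<close>

text \<open>Rules are schematic in terms, so substituting into an instance yields an instance. Hence
  the \<open>\<sigma>\<close> of \<open>ured_rule\<close> can be absorbed, and a head step is just a
  \<open>red_rule\<close>.\<close>

lemma red_rule_subst: "red_rule l r \<Longrightarrow> red_rule (subst \<sigma> l) (subst \<sigma> r)"
  by (induction rule: red_rule.induct) (simp_all add: subst_subst1 subst_subst2 red_rule.intros)

lemma red_rule_ured: "red_rule l r \<Longrightarrow> l \<leadsto> r"
  using ured_rule [of l r Var] by (simp add: subst_Var)

inductive_simps red_rule_simps:
  "red_rule (Var n) s" "red_rule (Par t u) s" "red_rule Star s" "red_rule (DeltaBot t) s"
  "red_rule (Lam t) s" "red_rule (App t u) s" "red_rule (Pair t u) s" "red_rule (DeltaConj t u) s"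
  "red_rule (InL t) s" "red_rule (InR t) s" "red_rule (DeltaDisj t u v) s" "red_rule (Plus t u) s"
  "red_rule (DeltaOdot t u v) s" "red_rule (DeltaOdotPar t u v) s"

text \<open>In this and the following inversions, the case \<open>ured_rule\<close> hides the head
  of the term in \<open>subst \<sigma> l\<close>; \<open>red_rule_subst\<close> restores a rule
  instance on the visible constructor.\<close>

lemma ured_VarD: "\<not> Var n \<leadsto> s"
  by (auto elim!: ured.cases dest: red_rule_subst simp: red_rule_simps)
    (metis red_rule_subst red_rule_simps(1))

lemma ured_StarD: "\<not> Star \<leadsto> s"
  by (auto elim!: ured.cases) (metis red_rule_subst red_rule_simps(3))

lemma ured_ParD:
  "Par t u \<leadsto> s \<Longrightarrow> red_rule (Par t u) s
    \<or> (\<exists>t'. t \<leadsto> t' \<and> s = Par t' u) \<or> (\<exists>u'. u \<leadsto> u' \<and> s = Par t u')"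
  by (erule ured.cases) (auto dest: red_rule_subst)

lemma ured_DeltaBotD: "DeltaBot t \<leadsto> s \<Longrightarrow> \<exists>t'. t \<leadsto> t' \<and> s = DeltaBot t'"
  by (erule ured.cases) (auto, metis red_rule_subst red_rule_simps(4))

lemma ured_LamD: "Lam t \<leadsto> s \<Longrightarrow> \<exists>t'. t \<leadsto> t' \<and> s = Lam t'"
  by (erule ured.cases) (auto, metis red_rule_subst red_rule_simps(5))

lemma ured_AppD:
  "App t u \<leadsto> s \<Longrightarrow> red_rule (App t u) s
    \<or> (\<exists>t'. t \<leadsto> t' \<and> s = App t' u) \<or> (\<exists>u'. u \<leadsto> u' \<and> s = App t u')"
  by (erule ured.cases) (auto dest: red_rule_subst)

lemma ured_PairD:
  "Pair t u \<leadsto> s \<Longrightarrow> (\<exists>t'. t \<leadsto> t' \<and> s = Pair t' u) \<or> (\<exists>u'. u \<leadsto> u' \<and> s = Pair t u')"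
  by (erule ured.cases) (auto, metis red_rule_subst red_rule_simps(7))

lemma ured_DeltaConjD:
  "DeltaConj t u \<leadsto> s \<Longrightarrow> red_rule (DeltaConj t u) s
    \<or> (\<exists>t'. t \<leadsto> t' \<and> s = DeltaConj t' u) \<or> (\<exists>u'. u \<leadsto> u' \<and> s = DeltaConj t u')"
  by (erule ured.cases) (auto dest: red_rule_subst)

lemma ured_InLD: "InL t \<leadsto> s \<Longrightarrow> \<exists>t'. t \<leadsto> t' \<and> s = InL t'"
  by (erule ured.cases) (auto, metis red_rule_subst red_rule_simps(9))

lemma ured_InRD: "InR t \<leadsto> s \<Longrightarrow> \<exists>t'. t \<leadsto> t' \<and> s = InR t'"
  by (erule ured.cases) (auto, metis red_rule_subst red_rule_simps(10))

lemma ured_DeltaDisjD: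
  "DeltaDisj t u v \<leadsto> s \<Longrightarrow> red_rule (DeltaDisj t u v) s
    \<or> (\<exists>t'. t \<leadsto> t' \<and> s = DeltaDisj t' u v) \<or> (\<exists>u'. u \<leadsto> u' \<and> s = DeltaDisj t u' v)
    \<or> (\<exists>v'. v \<leadsto> v' \<and> s = DeltaDisj t u v')"
  by (erule ured.cases) (auto dest: red_rule_subst)

lemma ured_PlusD:
  "Plus t u \<leadsto> s \<Longrightarrow> (\<exists>t'. t \<leadsto> t' \<and> s = Plus t' u) \<or> (\<exists>u'. u \<leadsto> u' \<and> s = Plus t u')"
  by (erule ured.cases) (auto, metis red_rule_subst red_rule_simps(12))

lemma ured_DeltaOdotD:
  "DeltaOdot t u v \<leadsto> s \<Longrightarrow> red_rule (DeltaOdot t u v) s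
    \<or> (\<exists>t'. t \<leadsto> t' \<and> s = DeltaOdot t' u v) \<or> (\<exists>u'. u \<leadsto> u' \<and> s = DeltaOdot t u' v)
    \<or> (\<exists>v'. v \<leadsto> v' \<and> s = DeltaOdot t u v')"
  by (erule ured.cases) (auto dest: red_rule_subst)

lemma ured_DeltaOdotParD:
  "DeltaOdotPar t u v \<leadsto> s \<Longrightarrow> red_rule (DeltaOdotPar t u v) s
    \<or> (\<exists>t'. t \<leadsto> t' \<and> s = DeltaOdotPar t' u v) \<or> (\<exists>u'. u \<leadsto> u' \<and> s = DeltaOdotPar t u' v)
    \<or> (\<exists>v'. v \<leadsto> v' \<and> s = DeltaOdotPar t u v')"
  by (erule ured.cases) (auto dest: red_rule_subst)

section \<open>Many-step reductions from introductions and from \<open>Par\<close>\<close>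

lemma ureds_LamD: "Lam t \<leadsto>* s \<Longrightarrow> \<exists>t'. t \<leadsto>* t' \<and> s = Lam t'"
  by (induction rule: rtranclp_induct) (auto dest!: ured_LamD intro: rtranclp.rtrancl_into_rtrancl)

lemma ureds_InLD: "InL t \<leadsto>* s \<Longrightarrow> \<exists>t'. t \<leadsto>* t' \<and> s = InL t'"
  by (induction rule: rtranclp_induct) (auto dest!: ured_InLD intro: rtranclp.rtrancl_into_rtrancl)

lemma ureds_InRD: "InR t \<leadsto>* s \<Longrightarrow> \<exists>t'. t \<leadsto>* t' \<and> s = InR t'"
  by (induction rule: rtranclp_induct) (auto dest!: ured_InRD intro: rtranclp.rtrancl_into_rtrancl)

lemma ureds_PairD: "Pair t u \<leadsto>* s \<Longrightarrow> \<exists>t' u'. t \<leadsto>* t' \<and> u \<leadsto>* u' \<and> s = Pair t' u'"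
  by (induction rule: rtranclp_induct) (auto dest!: ured_PairD intro: rtranclp.rtrancl_into_rtrancl)

lemma ureds_PlusD: "Plus t u \<leadsto>* s \<Longrightarrow> \<exists>t' u'. t \<leadsto>* t' \<and> u \<leadsto>* u' \<and> s = Plus t' u'"
  by (induction rule: rtranclp_induct) (auto dest!: ured_PlusD intro: rtranclp.rtrancl_into_rtrancl)

text \<open>Reduction stays componentwise until a head step projects \<open>Par\<close> or commutes
  it with a common introduction, which then remains at the head. No rule commutes \<open>Par\<close>
  with injections, hence no disjunct for them.\<close>

lemma ureds_ParD:
  "Par t u \<leadsto>* s \<Longrightarrow>
    (\<exists>t' u'. t \<leadsto>* t' \<and> u \<leadsto>* u' \<and> s = Par t' u') \<or> t \<leadsto>* s \<or> u \<leadsto>* s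
    \<or> (\<exists>t1 u1 s1. t \<leadsto>* Lam t1 \<and> u \<leadsto>* Lam u1 \<and> Par t1 u1 \<leadsto>* s1 \<and> s = Lam s1)
    \<or> (\<exists>t1 t2 u1 u2 s1 s2. t \<leadsto>* Pair t1 t2 \<and> u \<leadsto>* Pair u1 u2
         \<and> Par t1 u1 \<leadsto>* s1 \<and> Par t2 u2 \<leadsto>* s2 \<and> s = Pair s1 s2)
    \<or> (\<exists>t1 t2 u1 u2 s1 s2. t \<leadsto>* Plus t1 t2 \<and> u \<leadsto>* Plus u1 u2
         \<and> Par t1 u1 \<leadsto>* s1 \<and> Par t2 u2 \<leadsto>* s2 \<and> s = Plus s1 s2)"
  (is "_ \<Longrightarrow> ?P s")
proof (induction rule: rtranclp_induct)
  case base
  then show ?case by blast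
next
  case (step y z)
  from step.IH show ?case
  proof (elim disjE exE conjE)
    fix t' u' assume *: "t \<leadsto>* t'" "u \<leadsto>* u'" "y = Par t' u'"
    from step.hyps(2) have "Par t' u' \<leadsto> z" by (simp add: *)
    then consider (r) "red_rule (Par t' u') z" | (1) t'' where "t' \<leadsto> t''" "z = Par t'' u'"
      | (2) u'' where "u' \<leadsto> u''" "z = Par t' u''" by (blast dest: ured_ParD)
    then show ?thesis
    proof cases
      case r
      then show ?thesis using *(1,2) by (simp add: red_rule_simps) blast
    next
      case 1
      with *(1) have "t \<leadsto>* t''" by simp
      with *(2) 1(2) show ?thesis by blast
    next
      case 2
      with *(2) have "u \<leadsto>* u''" by simp
      with *(1) 2(2) show ?thesis by blast
    qed
  next
    assume "t \<leadsto>* y" with step.hyps(2) show ?thesis by (simp add: rtranclp.rtrancl_into_rtrancl)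
  next
    assume "u \<leadsto>* y" with step.hyps(2) show ?thesis by (simp add: rtranclp.rtrancl_into_rtrancl)
  next
    fix t1 u1 s1
    assume *: "t \<leadsto>* Lam t1" "u \<leadsto>* Lam u1" "Par t1 u1 \<leadsto>* s1" "y = Lam s1"
    with step.hyps(2) obtain s2 where "s1 \<leadsto> s2" "z = Lam s2" by (blast dest: ured_LamD)
    moreover from this * have "Par t1 u1 \<leadsto>* s2" by simp
    ultimately show ?thesis using * by blast
  next
    fix t1 t2 u1 u2 s1 s2
    assume *: "t \<leadsto>* Pair t1 t2" "u \<leadsto>* Pair u1 u2" "Par t1 u1 \<leadsto>* s1" "Par t2 u2 \<leadsto>* s2"
      "y = Pair s1 s2"
    then have "Pair s1 s2 \<leadsto>* z" using step.hyps(2) by blast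
    then obtain r1 r2 where r: "s1 \<leadsto>* r1" "s2 \<leadsto>* r2" "z = Pair r1 r2" by (blast dest: ureds_PairD)
    have "Par t1 u1 \<leadsto>* r1" "Par t2 u2 \<leadsto>* r2"
      using *(3,4) r(1,2) by (meson rtranclp_trans)+
    with *(1,2) r(3) show ?thesis by blast
  next
    fix t1 t2 u1 u2 s1 s2
    assume *: "t \<leadsto>* Plus t1 t2" "u \<leadsto>* Plus u1 u2" "Par t1 u1 \<leadsto>* s1" "Par t2 u2 \<leadsto>* s2"
      "y = Plus s1 s2"
    then have "Plus s1 s2 \<leadsto>* z" using step.hyps(2) by blast
    then obtain r1 r2 where r: "s1 \<leadsto>* r1" "s2 \<leadsto>* r2" "z = Plus r1 r2" by (blast dest: ureds_PlusD)
    have "Par t1 u1 \<leadsto>* r1" "Par t2 u2 \<leadsto>* r2"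
      using *(3,4) r(1,2) by (meson rtranclp_trans)+
    with *(1,2) r(3) show ?thesis by blast
  qed
qed

lemma ured_subst: "t \<leadsto> t' \<Longrightarrow> subst \<tau> t \<leadsto> subst \<tau> t'"
  by (induction arbitrary: \<tau> rule: ured.induct)
    (auto simp: red_rule_subst red_rule_ured intro: ured.intros)

lemma ured_subst1: "t \<leadsto> t' \<Longrightarrow> subst1 a t \<leadsto> subst1 a t'"
  by (simp add: subst1_def ured_subst)

lemma ured_subst2: "t \<leadsto> t' \<Longrightarrow> subst2 a b t \<leadsto> subst2 a b t'"
  by (simp add: subst2_def ured_subst)

lemma ureds_subst1: "t \<leadsto>* t' \<Longrightarrow> subst1 a t \<leadsto>* subst1 a t'"
  by (induction rule: rtranclp_induct) (auto intro: ured_subst1 rtranclp.rtrancl_into_rtrancl)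

section \<open>Strong termination\<close>

text \<open>Accessibility for the converse of reduction supplies the induction principle that the
  absence of infinite sequences hides.\<close>

lemma strongly_terminates_iff_accp: "strongly_terminates t \<longleftrightarrow> Wellfounded.accp (\<lambda>s t. t \<leadsto> s) t"
proof
  assume t: "strongly_terminates t"
  show "Wellfounded.accp (\<lambda>s t. t \<leadsto> s) t"
  proof (rule ccontr)
    assume "\<not> Wellfounded.accp (\<lambda>s t. t \<leadsto> s) t"
    moreover have "\<exists>u. \<not> Wellfounded.accp (\<lambda>s t. t \<leadsto> s) u \<and> s \<leadsto> u"
      if "\<not> Wellfounded.accp (\<lambda>s t. t \<leadsto> s) s" for s
      using accp.accI [of "\<lambda>s t. t \<leadsto> s" s] that by auto
    \<comment> \<open>Dependent choice runs along inaccessible terms, each having an inaccessible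
      reduct; the clause for \<open>i = 0\<close> pins the starting term.\<close>
    ultimately have "\<exists>f. \<forall>i. (\<not> Wellfounded.accp (\<lambda>s t. t \<leadsto> s) (f i) \<and> (i = 0 \<longrightarrow> f i = t))
        \<and> f i \<leadsto> f (Suc i)"
      by (intro dependent_nat_choice) blast+
    then have "\<exists>f. f 0 = t \<and> (\<forall>i. f i \<leadsto> f (Suc i))" by blast
    with t show False unfolding strongly_terminates_def by blast
  qed
next
  assume "Wellfounded.accp (\<lambda>s t. t \<leadsto> s) t"
  then show "strongly_terminates t"
  proof (induction rule: accp.induct)
    case (accI t)
    show ?case unfolding strongly_terminates_def
    proof (rule notI, elim exE conjE)
      fix f :: "nat \<Rightarrow> trm" assume f: "f 0 = t" "\<forall>i. f i \<leadsto> f (Suc i)"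
      then have "strongly_terminates (f (Suc 0))" using accI.IH by auto
      moreover have "\<exists>g. g 0 = f (Suc 0) \<and> (\<forall>i. g i \<leadsto> g (Suc i))"
        using f(2) by (intro exI [of _ "\<lambda>i. f (Suc i)"]) simp
      ultimately show False unfolding strongly_terminates_def by blast
    qed
  qed
qed

lemma strongly_terminatesI: "(\<And>s. t \<leadsto> s \<Longrightarrow> strongly_terminates s) \<Longrightarrow> strongly_terminates t"
  unfolding strongly_terminates_iff_accp by (rule accp.accI) simp

lemma strongly_terminates_ured: "strongly_terminates t \<Longrightarrow> t \<leadsto> s \<Longrightarrow> strongly_terminates s"
  unfolding strongly_terminates_iff_accp by (rule accp_downward) simp_all

lemma strongly_terminates_ureds: "t \<leadsto>* s \<Longrightarrow> strongly_terminates t \<Longrightarrow> strongly_terminates s"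
  by (induction rule: rtranclp_induct) (auto intro: strongly_terminates_ured)

lemma strongly_terminates_induct [consumes 1, case_names step]:
  assumes "strongly_terminates t"
    and "\<And>t. strongly_terminates t \<Longrightarrow> (\<And>s. t \<leadsto> s \<Longrightarrow> P s) \<Longrightarrow> P t"
  shows "P t"
  using assms unfolding strongly_terminates_iff_accp
  by (induction rule: accp.induct) (simp add: accp.accI)

text \<open>Every step of \<open>t\<close> is mirrored by a step of \<open>subst \<tau> t\<close>.
  This is how the body of a binder inherits termination from one of its instances.\<close>

lemma strongly_terminates_subst: "strongly_terminates (subst \<tau> t) \<Longrightarrow> strongly_terminates t"
proof (induction "subst \<tau> t" arbitrary: t rule: strongly_terminates_induct)
  case step
  then show ?case by (blast intro: strongly_terminatesI ured_subst)
qed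

lemma strongly_terminates_Lam: "strongly_terminates t \<Longrightarrow> strongly_terminates (Lam t)"
  by (induction rule: strongly_terminates_induct)
    (auto intro: strongly_terminatesI dest!: ured_LamD)

lemma strongly_terminates_InL: "strongly_terminates t \<Longrightarrow> strongly_terminates (InL t)"
  by (induction rule: strongly_terminates_induct)
    (auto intro: strongly_terminatesI dest!: ured_InLD)

lemma strongly_terminates_InR: "strongly_terminates t \<Longrightarrow> strongly_terminates (InR t)"
  by (induction rule: strongly_terminates_induct)
    (auto intro: strongly_terminatesI dest!: ured_InRD)

lemma strongly_terminates_Pair:
  "strongly_terminates t \<Longrightarrow> strongly_terminates u \<Longrightarrow> strongly_terminates (Pair t u)"
proof (induction t arbitrary: u rule: strongly_terminates_induct)
  case t: (step t)
  from t.prems show ?case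
  proof (induction u rule: strongly_terminates_induct)
    case (step u)
    then show ?case by (blast intro: strongly_terminatesI t.IH dest!: ured_PairD)
  qed
qed

lemma strongly_terminates_Plus:
  "strongly_terminates t \<Longrightarrow> strongly_terminates u \<Longrightarrow> strongly_terminates (Plus t u)"
proof (induction t arbitrary: u rule: strongly_terminates_induct)
  case t: (step t)
  from t.prems show ?case
  proof (induction u rule: strongly_terminates_induct)
    case (step u)
    then show ?case by (blast intro: strongly_terminatesI t.IH dest!: ured_PlusD)
  qed
qed

text \<open>Only the constructors with which \<open>Par\<close> commutes are needed.\<close>

inductive subterm :: "trm \<Rightarrow> trm \<Rightarrow> bool" where
  "subterm (Lam t) t"
| "subterm (Pair t u) t"
| "subterm (Pair t u) u"
| "subterm (Plus t u) t"
| "subterm (Plus t u) u"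

abbreviation terminates_under_subterm :: "trm \<Rightarrow> bool" where
  "terminates_under_subterm \<equiv> Wellfounded.accp (\<lambda>s t. t \<leadsto> s \<or> subterm t s)"

text \<open>Reduction is contextual, so a step in a subterm lifts to the whole term: descents to
  subterms can be postponed past reductions.\<close>

lemma subterm_ured: "subterm t s \<Longrightarrow> s \<leadsto> s' \<Longrightarrow> \<exists>t'. t \<leadsto> t' \<and> subterm t' s'"
  by (induction rule: subterm.induct) (blast intro: ured.intros subterm.intros)+

lemma subterms_ured:
  "subterm\<^sup>*\<^sup>* t s \<Longrightarrow> s \<leadsto> s' \<Longrightarrow> \<exists>t'. t \<leadsto> t' \<and> subterm\<^sup>*\<^sup>* t' s'"
  by (induction arbitrary: s' rule: rtranclp_induct)
    (blast, meson subterm_ured rtranclp.rtrancl_into_rtrancl)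

lemma subterm_size: "subterm t s \<Longrightarrow> size s < size t"
  by (induction rule: subterm.induct) simp_all

lemma terminates_under_subterm_subterms:
  "subterm\<^sup>*\<^sup>* t s \<Longrightarrow> terminates_under_subterm t \<Longrightarrow> terminates_under_subterm s"
  by (induction rule: rtranclp_induct) (auto intro: accp_downward)

text \<open>Adding descents to subterms creates no infinite sequence: reductions can be moved before
  descents, and descents alone decrease size.\<close>

lemma terminates_under_subtermI:
  "strongly_terminates t \<Longrightarrow> terminates_under_subterm t"
proof (induction rule: strongly_terminates_induct)
  case (step t)
  \<comment> \<open>The claim is strengthened to all iterated subterms of \<open>t\<close>, so that
    the inner induction on size can descend while \<open>t\<close> stays fixed.\<close>
  have "terminates_under_subterm s" if "subterm\<^sup>*\<^sup>* t s" for s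
    using that
  proof (induction s rule: measure_induct_rule [of size])
    case (less s)
    show ?case
    proof (rule accp.accI)
      fix r assume "s \<leadsto> r \<or> subterm s r"
      then consider "s \<leadsto> r" | "subterm s r" by auto
      then show "terminates_under_subterm r"
      proof cases
        case 1
        with less.prems obtain t' where "t \<leadsto> t'" "subterm\<^sup>*\<^sup>* t' r" using subterms_ured by blast
        with step.IH show ?thesis by (blast intro: terminates_under_subterm_subterms)
      next
        case 2
        with less.prems have "subterm\<^sup>*\<^sup>* t r" by simp
        with subterm_size [OF 2] show ?thesis by (rule less.IH)
      qed
    qed
  qed
  then show ?case by blast
qed

text \<open>Commuting rules put \<open>Par\<close> around components of \<open>t\<close> and
  \<open>u\<close>, which need not be reducts of them. So the outer induction follows both reduction
  and subterms of \<open>t\<close>, with \<open>u\<close> arbitrary; the inner one follows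
  reductions of \<open>u\<close>.\<close>

lemma strongly_terminates_Par:
  assumes "strongly_terminates t" "strongly_terminates u"
  shows "strongly_terminates (Par t u)"
proof -
  have "terminates_under_subterm t" using assms(1) by (rule terminates_under_subtermI)
  then show ?thesis using assms
  proof (induction t arbitrary: u rule: accp.induct)
    case t: (accI t)
    have IH: "strongly_terminates (Par t' u')"
      if "t \<leadsto> t' \<or> subterm t t'" "strongly_terminates t'" "strongly_terminates u'" for t' u'
      using that t.IH by auto
    \<comment> \<open>\<open>IH\<close> demands terminating arguments: components of a terminating
      introduction terminate because their steps lift.\<close>
    have sub: "strongly_terminates s" if "strongly_terminates r" "subterm r s" for r s
      using that
      by (induction r arbitrary: s rule: strongly_terminates_induct)
        (meson strongly_terminatesI subterm_ured)
    from t.prems(2) show ?case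
    proof (induction u rule: strongly_terminates_induct)
      case (step u)
      show ?case
      proof (rule strongly_terminatesI)
        fix s assume "Par t u \<leadsto> s"
        then consider (r) "red_rule (Par t u) s" | (1) t' where "t \<leadsto> t'" "s = Par t' u"
          | (2) u' where "u \<leadsto> u'" "s = Par t u'" by (blast dest: ured_ParD)
        then show "strongly_terminates s"
        proof cases
          case r
          then show ?thesis using \<open>strongly_terminates t\<close> \<open>strongly_terminates u\<close>
            by (auto simp: red_rule_simps
                intro!: strongly_terminates_Lam strongly_terminates_Pair strongly_terminates_Plus IH
                intro: subterm.intros sub)
        next
          case 1
          then show ?thesis using IH step.hyps t.prems by (blast intro: strongly_terminates_ured)
        next
          case 2
          then show ?thesis using step.IH by blast
        qed
      qed
    qed
  qed
qed

section \<open>Reducibility\<close>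

lemma interp_strongly_terminates: "t \<in> \<lbrakk>A\<rbrakk> \<Longrightarrow> strongly_terminates t"
  by (cases A) auto

lemma interp_ureds: "t \<leadsto>* s \<Longrightarrow> t \<in> \<lbrakk>A\<rbrakk> \<Longrightarrow> s \<in> \<lbrakk>A\<rbrakk>"
  by (cases A) (auto intro: strongly_terminates_ureds dest: rtranclp_trans)

lemma interp_ured: "t \<leadsto> s \<Longrightarrow> t \<in> \<lbrakk>A\<rbrakk> \<Longrightarrow> s \<in> \<lbrakk>A\<rbrakk>"
  by (blast intro: interp_ureds)

text \<open>The exceptions are the introductions whose shape \<open>interp\<close> inspects.
  \<open>Star\<close>, which has no components, and \<open>Par\<close>, in spite of its commuting
  rules, count as neutral.\<close>

fun neutral :: "trm \<Rightarrow> bool" where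
  "neutral (Lam _) = False"
| "neutral (Pair _ _) = False"
| "neutral (InL _) = False"
| "neutral (InR _) = False"
| "neutral (Plus _ _) = False"
| "neutral _ = True"

text \<open>A neutral term is not itself of a shape that \<open>interp\<close> inspects, so any
  reduction to such a shape has a first step, and the reduct reached there already lies in
  \<open>\<lbrakk>A\<rbrakk>\<close>.\<close>

lemma interp_neutral:
  assumes "neutral t" and red: "\<And>s. t \<leadsto> s \<Longrightarrow> s \<in> \<lbrakk>A\<rbrakk>"
  shows "t \<in> \<lbrakk>A\<rbrakk>"
proof -
  have st: "strongly_terminates t"
    using red by (blast intro: strongly_terminatesI interp_strongly_terminates)
  have first: "\<exists>r. r \<in> \<lbrakk>A\<rbrakk> \<and> r \<leadsto>* s" if "t \<leadsto>* s" "\<not> neutral s" for s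
    using that assms by (metis converse_rtranclpE)
  show ?thesis
    using st by (cases A) (auto dest!: first)
qed

text \<open>A variable is neutral and has no reducts. Consequently no
  \<open>\<lbrakk>A\<rbrakk>\<close> is empty.\<close>

lemma Var_interp: "Var n \<in> \<lbrakk>A\<rbrakk>"
  by (rule interp_neutral) (simp_all add: ured_VarD)

text \<open>Variables inhabit \<open>\<lbrakk>A\<rbrakk>\<close>, so some instance of
  \<open>u\<close> terminates, and substitution reflects termination.\<close>

lemma strongly_terminates_if_subst1_interp:
  assumes "\<forall>v\<in>\<lbrakk>A\<rbrakk>. subst1 v u \<in> \<lbrakk>B\<rbrakk>"
  shows "strongly_terminates u"
  using assms Var_interp interp_strongly_terminates strongly_terminates_subst
  unfolding subst1_def by blast

lemma strongly_terminates_if_subst2_interp: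
  assumes "\<forall>a\<in>\<lbrakk>A\<rbrakk>. \<forall>b\<in>\<lbrakk>B\<rbrakk>. subst2 a b u \<in> \<lbrakk>C\<rbrakk>"
  shows "strongly_terminates u"
  using assms Var_interp interp_strongly_terminates strongly_terminates_subst
  unfolding subst2_def by blast

section \<open>Adequacy of the introductions and of \<open>Par\<close>\<close>

lemma Star_interp: "Star \<in> \<lbrakk>Top\<rbrakk>"
  by (rule interp_neutral) (simp_all add: ured_StarD)

text \<open>Reducts of \<open>Lam u\<close> are abstractions of reducts \<open>u'\<close> of
  \<open>u\<close>, and \<open>subst1 v u \<leadsto>* subst1 v u'\<close> carries the assumption
  over.\<close>

lemma Lam_interp:
  assumes "\<forall>v\<in>\<lbrakk>A\<rbrakk>. subst1 v u \<in> \<lbrakk>B\<rbrakk>"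
  shows "Lam u \<in> \<lbrakk>Imp A B\<rbrakk>"
  using assms
  by (auto dest!: ureds_LamD
      intro: strongly_terminates_Lam strongly_terminates_if_subst1_interp interp_ureds ureds_subst1)

lemma Pair_interp: "t \<in> \<lbrakk>A\<rbrakk> \<Longrightarrow> u \<in> \<lbrakk>B\<rbrakk> \<Longrightarrow> Pair t u \<in> \<lbrakk>Conj A B\<rbrakk>"
  by (auto dest!: ureds_PairD
      intro: strongly_terminates_Pair interp_strongly_terminates interp_ureds)

lemma Plus_interp: "t \<in> \<lbrakk>A\<rbrakk> \<Longrightarrow> u \<in> \<lbrakk>B\<rbrakk> \<Longrightarrow> Plus t u \<in> \<lbrakk>Odot A B\<rbrakk>"
  by (auto dest!: ureds_PlusD
      intro: strongly_terminates_Plus interp_strongly_terminates interp_ureds)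

lemma InL_interp: "t \<in> \<lbrakk>A\<rbrakk> \<Longrightarrow> InL t \<in> \<lbrakk>Disj A B\<rbrakk>"
  by (auto dest!: ureds_InLD
      intro: strongly_terminates_InL interp_strongly_terminates interp_ureds)

lemma InR_interp: "t \<in> \<lbrakk>B\<rbrakk> \<Longrightarrow> InR t \<in> \<lbrakk>Disj A B\<rbrakk>"
  by (auto dest!: ureds_InRD
      intro: strongly_terminates_InR interp_strongly_terminates interp_ureds)

text \<open>Induction on the proposition: an introduction reached from \<open>Par t u\<close> comes
  from \<open>t\<close>, from \<open>u\<close>, or from a commutation, which leaves
  \<open>Par\<close> of components at smaller propositions.\<close>

lemma Par_interp: "t \<in> \<lbrakk>A\<rbrakk> \<Longrightarrow> u \<in> \<lbrakk>A\<rbrakk> \<Longrightarrow> Par t u \<in> \<lbrakk>A\<rbrakk>"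
proof (induction A arbitrary: t u)
  case (Imp A B)
  have "subst1 v s \<in> \<lbrakk>B\<rbrakk>" if red: "Par t u \<leadsto>* Lam s" and v: "v \<in> \<lbrakk>A\<rbrakk>" for s v
  proof -
    from red consider "t \<leadsto>* Lam s" | "u \<leadsto>* Lam s"
      | t1 u1 where "t \<leadsto>* Lam t1" "u \<leadsto>* Lam u1" "Par t1 u1 \<leadsto>* s"
      by (auto dest: ureds_ParD)
    then show ?thesis
    proof cases
      case 3
      then have "Par (subst1 v t1) (subst1 v u1) \<in> \<lbrakk>B\<rbrakk>" using Imp v by auto
      moreover have "Par (subst1 v t1) (subst1 v u1) \<leadsto>* subst1 v s"
        using ureds_subst1 [OF 3(3)] by (simp add: subst1_def)
      ultimately show ?thesis by (blast intro: interp_ureds)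
    qed (use Imp.prems v in auto)
  qed
  with Imp.prems show ?case by (simp add: strongly_terminates_Par)
next
  case (Conj A B)
  have "s1 \<in> \<lbrakk>A\<rbrakk> \<and> s2 \<in> \<lbrakk>B\<rbrakk>" if "Par t u \<leadsto>* Pair s1 s2" for s1 s2
  proof -
    from that consider "t \<leadsto>* Pair s1 s2" | "u \<leadsto>* Pair s1 s2"
      | t1 t2 u1 u2 where "t \<leadsto>* Pair t1 t2" "u \<leadsto>* Pair u1 u2"
          "Par t1 u1 \<leadsto>* s1" "Par t2 u2 \<leadsto>* s2"
      by (auto dest: ureds_ParD)
    then show ?thesis
    proof cases
      case 3
      then have "Par t1 u1 \<in> \<lbrakk>A\<rbrakk>" "Par t2 u2 \<in> \<lbrakk>B\<rbrakk>" using Conj by auto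
      with 3(3,4) show ?thesis by (blast intro: interp_ureds)
    qed (use Conj.prems in auto)
  qed
  with Conj.prems show ?case by (simp add: strongly_terminates_Par)
next
  case (Disj A B)
  then show ?case by (auto simp: strongly_terminates_Par dest!: ureds_ParD)
next
  case (Odot A B)
  have "s1 \<in> \<lbrakk>A\<rbrakk> \<and> s2 \<in> \<lbrakk>B\<rbrakk>" if "Par t u \<leadsto>* Plus s1 s2" for s1 s2
  proof -
    from that consider "t \<leadsto>* Plus s1 s2" | "u \<leadsto>* Plus s1 s2"
      | t1 t2 u1 u2 where "t \<leadsto>* Plus t1 t2" "u \<leadsto>* Plus u1 u2"
          "Par t1 u1 \<leadsto>* s1" "Par t2 u2 \<leadsto>* s2"
      by (auto dest: ureds_ParD)
    then show ?thesis
    proof cases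
      case 3
      then have "Par t1 u1 \<in> \<lbrakk>A\<rbrakk>" "Par t2 u2 \<in> \<lbrakk>B\<rbrakk>" using Odot by auto
      with 3(3,4) show ?thesis by (blast intro: interp_ureds)
    qed (use Odot.prems in auto)
  qed
  with Odot.prems show ?case by (simp add: strongly_terminates_Par)
qed (simp_all add: strongly_terminates_Par)

section \<open>Adequacy of the eliminations\<close>

lemma DeltaBot_interp:
  assumes "t \<in> \<lbrakk>Bot\<rbrakk>" shows "DeltaBot t \<in> \<lbrakk>C\<rbrakk>"
proof -
  have "strongly_terminates t" using assms by simp
  then show ?thesis
  proof (induction rule: strongly_terminates_induct)
    case (step t)
    \<comment> \<open>No rule contracts \<open>DeltaBot\<close> at the head, so every reduct comes
      from a step in \<open>t\<close>.\<close>
    show ?case by (rule interp_neutral) (auto dest!: ured_DeltaBotD step.IH)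
  qed
qed

text \<open>An application is neutral, so its one-step reducts suffice. Nested inductions on
  termination handle the steps in \<open>t\<close> and \<open>u\<close>; a contraction uses the
  definition of \<open>\<lbrakk>Imp A B\<rbrakk>\<close> with the empty reduction.\<close>

lemma App_interp:
  assumes "t \<in> \<lbrakk>Imp A B\<rbrakk>" "u \<in> \<lbrakk>A\<rbrakk>"
  shows "App t u \<in> \<lbrakk>B\<rbrakk>"
proof -
  have "strongly_terminates t" using assms(1) by (rule interp_strongly_terminates)
  then show ?thesis using assms
  proof (induction t arbitrary: u rule: strongly_terminates_induct)
    case t: (step t)
    have "strongly_terminates u" using t.prems(2) by (rule interp_strongly_terminates)
    then show ?case using t.prems(2)
    proof (induction u rule: strongly_terminates_induct)
      case u: (step u)
      show ?case
      proof (rule interp_neutral)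
        fix s assume "App t u \<leadsto> s"
        then consider (r) "red_rule (App t u) s" | (1) t' where "t \<leadsto> t'" "s = App t' u"
          | (2) u' where "u \<leadsto> u'" "s = App t u'" by (blast dest: ured_AppD)
        then show "s \<in> \<lbrakk>B\<rbrakk>"
        proof cases
          case r
          then show ?thesis using t.prems(1) u.prems by (auto simp: red_rule_simps)
        next
          case 1
          then show ?thesis using t.IH t.prems(1) u.prems interp_ured by blast
        next
          case 2
          then show ?thesis using u.IH u.prems interp_ured by blast
        qed
      qed simp
    qed
  qed
qed

text \<open>As for application, but the second induction is on the open body \<open>u\<close>, which
  terminates because its instances do; \<open>ured_subst2\<close> preserves the hypothesis on
  \<open>u\<close> along its reductions.\<close>

lemma DeltaConj_interp:
  assumes "t \<in> \<lbrakk>Conj A B\<rbrakk>" "\<forall>a\<in>\<lbrakk>A\<rbrakk>. \<forall>b\<in>\<lbrakk>B\<rbrakk>. subst2 a b u \<in> \<lbrakk>C\<rbrakk>"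
  shows "DeltaConj t u \<in> \<lbrakk>C\<rbrakk>"
proof -
  have "strongly_terminates t" using assms(1) by (rule interp_strongly_terminates)
  then show ?thesis using assms
  proof (induction t arbitrary: u rule: strongly_terminates_induct)
    case t: (step t)
    have "strongly_terminates u" using t.prems(2) by (rule strongly_terminates_if_subst2_interp)
    then show ?case using t.prems(2)
    proof (induction u rule: strongly_terminates_induct)
      case u: (step u)
      show ?case
      proof (rule interp_neutral)
        fix s assume "DeltaConj t u \<leadsto> s"
        then consider (r) "red_rule (DeltaConj t u) s"
          | (1) t' where "t \<leadsto> t'" "s = DeltaConj t' u"
          | (2) u' where "u \<leadsto> u'" "s = DeltaConj t u'" by (blast dest: ured_DeltaConjD)
        then show "s \<in> \<lbrakk>C\<rbrakk>"
        proof cases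
          case r
          then show ?thesis using t.prems(1) u.prems by (auto simp: red_rule_simps)
        next
          case 1
          then show ?thesis using t.IH t.prems(1) u.prems interp_ured by blast
        next
          case 2
          then show ?thesis using u.IH u.prems interp_ured ured_subst2 by blast
        qed
      qed simp
    qed
  qed
qed

text \<open>Shared by the three eliminations with two branches: \<open>D\<close> is the constructor,
  \<open>E\<close> the proposition of its principal argument, and \<open>head\<close> settles
  contractions. The premise of \<open>head\<close> on reducts of \<open>t\<close> serves the rule
  commuting \<open>DeltaDisj\<close> with \<open>Par\<close>.\<close>

lemma branching_interp:
  assumes D: "\<And>t u v s. D t u v \<leadsto> s \<Longrightarrow> red_rule (D t u v) s
      \<or> (\<exists>t'. t \<leadsto> t' \<and> s = D t' u v) \<or> (\<exists>u'. u \<leadsto> u' \<and> s = D t u' v)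
      \<or> (\<exists>v'. v \<leadsto> v' \<and> s = D t u v')"
    and neutral: "\<And>t u v. neutral (D t u v)"
    and head: "\<And>t u v s. red_rule (D t u v) s \<Longrightarrow> t \<in> \<lbrakk>E\<rbrakk>
      \<Longrightarrow> \<forall>a\<in>\<lbrakk>A\<rbrakk>. subst1 a u \<in> \<lbrakk>C\<rbrakk> \<Longrightarrow> \<forall>b\<in>\<lbrakk>B\<rbrakk>. subst1 b v \<in> \<lbrakk>C\<rbrakk>
      \<Longrightarrow> (\<And>t'. t \<leadsto> t' \<Longrightarrow> D t' u v \<in> \<lbrakk>C\<rbrakk>) \<Longrightarrow> s \<in> \<lbrakk>C\<rbrakk>"
    and "t \<in> \<lbrakk>E\<rbrakk>" "\<forall>a\<in>\<lbrakk>A\<rbrakk>. subst1 a u \<in> \<lbrakk>C\<rbrakk>" "\<forall>b\<in>\<lbrakk>B\<rbrakk>. subst1 b v \<in> \<lbrakk>C\<rbrakk>"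
  shows "D t u v \<in> \<lbrakk>C\<rbrakk>"
proof -
  have "strongly_terminates t" using assms(4) by (rule interp_strongly_terminates)
  then show ?thesis using assms(4-)
  proof (induction t arbitrary: u v rule: strongly_terminates_induct)
    case t: (step t)
    have "strongly_terminates u" using t.prems(2) by (rule strongly_terminates_if_subst1_interp)
    then show ?case using t.prems(2,3)
    proof (induction u arbitrary: v rule: strongly_terminates_induct)
      case u: (step u)
      have "strongly_terminates v" using u.prems(2) by (rule strongly_terminates_if_subst1_interp)
      then show ?case using u.prems(2)
      proof (induction v rule: strongly_terminates_induct)
        case v: (step v)
        have t': "D t' u v \<in> \<lbrakk>C\<rbrakk>" if "t \<leadsto> t'" for t'
          using that t.IH t.prems(1) u.prems(1) v.prems interp_ured by blast
        show ?case
        proof (rule interp_neutral [OF neutral])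
          fix s assume "D t u v \<leadsto> s"
          then consider (r) "red_rule (D t u v) s" | (1) t' where "t \<leadsto> t'" "s = D t' u v"
            | (2) u' where "u \<leadsto> u'" "s = D t u' v" | (3) v' where "v \<leadsto> v'" "s = D t u v'"
            by (blast dest: D)
          then show "s \<in> \<lbrakk>C\<rbrakk>"
          proof cases
            case r
            then show ?thesis using head t.prems(1) u.prems(1) v.prems t' by blast
          next
            case 1
            then show ?thesis using t' by blast
          next
            case 2
            then show ?thesis using u.IH u.prems(1) v.prems interp_ured ured_subst1 by blast
          next
            case 3
            then show ?thesis using v.IH v.prems interp_ured ured_subst1 by blast
          qed
        qed
      qed
    qed
  qed
qed

lemma DeltaDisj_interp:
  assumes "t \<in> \<lbrakk>Disj A B\<rbrakk>" "\<forall>a\<in>\<lbrakk>A\<rbrakk>. subst1 a u \<in> \<lbrakk>C\<rbrakk>" "\<forall>b\<in>\<lbrakk>B\<rbrakk>. subst1 b v \<in> \<lbrakk>C\<rbrakk>"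
  shows "DeltaDisj t u v \<in> \<lbrakk>C\<rbrakk>"
proof (rule branching_interp [OF ured_DeltaDisjD _ _ assms])
  fix t u v s
  assume "red_rule (DeltaDisj t u v) s" "t \<in> \<lbrakk>Disj A B\<rbrakk>"
    "\<forall>a\<in>\<lbrakk>A\<rbrakk>. subst1 a u \<in> \<lbrakk>C\<rbrakk>" "\<forall>b\<in>\<lbrakk>B\<rbrakk>. subst1 b v \<in> \<lbrakk>C\<rbrakk>"
    "\<And>t'. t \<leadsto> t' \<Longrightarrow> DeltaDisj t' u v \<in> \<lbrakk>C\<rbrakk>"
  \<comment> \<open>\<open>Par t1 t2\<close> reduces to \<open>t1\<close> and to \<open>t2\<close>, so the last assumption covers the commuting rule.\<close>
  then show "s \<in> \<lbrakk>C\<rbrakk>"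
    by (auto simp: red_rule_simps
        intro!: Par_interp red_rule_ured rule_parL rule_parR)
qed simp_all

text \<open>The empty reduction in the definition of \<open>\<lbrakk>Odot A B\<rbrakk>\<close>,
  stated as a rule so that \<open>interp\<close> can stay folded below.\<close>

lemma Plus_interpD: "Plus t u \<in> \<lbrakk>Odot A B\<rbrakk> \<Longrightarrow> t \<in> \<lbrakk>A\<rbrakk> \<and> u \<in> \<lbrakk>B\<rbrakk>"
  by auto

lemma DeltaOdot_interp:
  assumes "t \<in> \<lbrakk>Odot A B\<rbrakk>" "\<forall>a\<in>\<lbrakk>A\<rbrakk>. subst1 a u \<in> \<lbrakk>C\<rbrakk>" "\<forall>b\<in>\<lbrakk>B\<rbrakk>. subst1 b v \<in> \<lbrakk>C\<rbrakk>"
  shows "DeltaOdot t u v \<in> \<lbrakk>C\<rbrakk>"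
  by (rule branching_interp [OF ured_DeltaOdotD _ _ assms])
    (auto simp: red_rule_simps simp del: interp.simps dest: Plus_interpD)

text \<open>The contraction yields \<open>Par\<close> of both branch instances, so closure under
  \<open>Par\<close> is used on top of the choice of a branch.\<close>

lemma DeltaOdotPar_interp:
  assumes "t \<in> \<lbrakk>Odot A B\<rbrakk>" "\<forall>a\<in>\<lbrakk>A\<rbrakk>. subst1 a u \<in> \<lbrakk>C\<rbrakk>" "\<forall>b\<in>\<lbrakk>B\<rbrakk>. subst1 b v \<in> \<lbrakk>C\<rbrakk>"
  shows "DeltaOdotPar t u v \<in> \<lbrakk>C\<rbrakk>"
  by (rule branching_interp [OF ured_DeltaOdotParD _ _ assms])
    (auto simp: red_rule_simps simp del: interp.simps dest: Plus_interpD intro!: Par_interp)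

section \<open>Induction on typing derivations\<close>

lemma case_nat_interp:
  assumes "a \<in> \<lbrakk>A\<rbrakk>" "\<And>i. i < length \<Gamma> \<Longrightarrow> \<sigma> i \<in> \<lbrakk>\<Gamma> ! i\<rbrakk>" "i < length (A # \<Gamma>)"
  shows "case_nat a \<sigma> i \<in> \<lbrakk>(A # \<Gamma>) ! i\<rbrakk>"
  using assms by (cases i) auto

theorem mainTheorem4:
  fixes \<Gamma> :: "fm list" and t :: trm and A :: fm and \<sigma> :: "nat \<Rightarrow> trm"
  assumes "\<Gamma> \<turnstile> t : A"
    and "\<And>i. i < length \<Gamma> \<Longrightarrow> \<sigma> i \<in> \<lbrakk>\<Gamma> ! i\<rbrakk>"
  shows "subst \<sigma> t \<in> \<lbrakk>A\<rbrakk>"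
  using assms
\<comment> \<open>Rules with binders invoke the induction hypothesis at extended substitutions such
  as \<open>case_nat a \<sigma>\<close>, so \<open>\<sigma>\<close> is generalised.\<close>
proof (induction arbitrary: \<sigma> rule: typing.induct)
  case (ty_Var i \<Gamma> A)
  then show ?case by auto
next
  case ty_Par
  then show ?case by (simp add: Par_interp)
next
  case ty_Star
  then show ?case using Star_interp by simp
next
  case ty_DeltaBot
  then show ?case by (simp add: DeltaBot_interp)
next
  case (ty_Lam A \<Gamma> t B)
  then have "\<forall>a\<in>\<lbrakk>A\<rbrakk>. subst1 a (subst (lift_sub \<sigma>) t) \<in> \<lbrakk>B\<rbrakk>"
    by (simp only: subst1_subst) (blast intro: case_nat_interp)
  then show ?case using Lam_interp by simp
next
  case ty_App
  then show ?case by (simp only: subst.simps) (blast intro: App_interp)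
next
  case ty_Pair
  then show ?case by (simp only: subst.simps) (blast intro: Pair_interp)
next
  case (ty_DeltaConj \<Gamma> t A B u C)
  \<comment> \<open>Here \<open>b\<close> goes to index 0 and \<open>a\<close> to index 1, matching
    the context \<open>B # A # \<Gamma>\<close>.\<close>
  then have "\<forall>a\<in>\<lbrakk>A\<rbrakk>. \<forall>b\<in>\<lbrakk>B\<rbrakk>. subst2 a b (subst (lift_sub (lift_sub \<sigma>)) u) \<in> \<lbrakk>C\<rbrakk>"
    by (simp only: subst2_subst) (blast intro: case_nat_interp)
  with ty_DeltaConj show ?case by (simp only: subst.simps) (blast intro: DeltaConj_interp)
next
  case ty_InL
  then show ?case by (simp only: subst.simps) (blast intro: InL_interp)
next
  case ty_InR
  then show ?case by (simp only: subst.simps) (blast intro: InR_interp)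
next
  case (ty_DeltaDisj \<Gamma> t A B u C v)
  then have "\<forall>a\<in>\<lbrakk>A\<rbrakk>. subst1 a (subst (lift_sub \<sigma>) u) \<in> \<lbrakk>C\<rbrakk>"
    "\<forall>b\<in>\<lbrakk>B\<rbrakk>. subst1 b (subst (lift_sub \<sigma>) v) \<in> \<lbrakk>C\<rbrakk>"
    by (simp_all only: subst1_subst) (blast intro: case_nat_interp)+
  with ty_DeltaDisj show ?case by (simp only: subst.simps) (blast intro: DeltaDisj_interp)
next
  case ty_Plus
  then show ?case by (simp only: subst.simps) (blast intro: Plus_interp)
next
  case (ty_DeltaOdot \<Gamma> t A B u C v)
  then have "\<forall>a\<in>\<lbrakk>A\<rbrakk>. subst1 a (subst (lift_sub \<sigma>) u) \<in> \<lbrakk>C\<rbrakk>"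
    "\<forall>b\<in>\<lbrakk>B\<rbrakk>. subst1 b (subst (lift_sub \<sigma>) v) \<in> \<lbrakk>C\<rbrakk>"
    by (simp_all only: subst1_subst) (blast intro: case_nat_interp)+
  with ty_DeltaOdot show ?case by (simp only: subst.simps) (blast intro: DeltaOdot_interp)
next
  case (ty_DeltaOdotPar \<Gamma> t A B u C v)
  then have "\<forall>a\<in>\<lbrakk>A\<rbrakk>. subst1 a (subst (lift_sub \<sigma>) u) \<in> \<lbrakk>C\<rbrakk>"
    "\<forall>b\<in>\<lbrakk>B\<rbrakk>. subst1 b (subst (lift_sub \<sigma>) v) \<in> \<lbrakk>C\<rbrakk>"
    by (simp_all only: subst1_subst) (blast intro: case_nat_interp)+
  with ty_DeltaOdotPar show ?case by (simp only: subst.simps) (blast intro: DeltaOdotPar_interp)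
qed

end
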